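(* Let $\kappa$ be a regular uncountable cardinal and $\lambda \geq \kappa$ a cardinal. Suppose that $\mathrm{tcf}(\prod A / I) = \lambda^+$, where (a) $A$ is a set of regular cardinals such that $|A| < \min\{\kappa, \min A\}$ and $\sup A = \lambda$; (b) $I$ is an ideal on $A$ such that $\{A \cap a : a \in A\} \subseteq I$; (c) $PS^+(|A|^+, \kappa, \lambda^+)$ holds. Let $\vec f = \langle f_\alpha : \alpha < \lambda^+ \rangle$ be an increasing, cofinal sequence in $(\prod A, <_I)$, and let $S$ denote the set of all infinite limit ordinals $\delta < \lambda^+$ such that $\mathrm{cf}(\delta) < \kappa$ and $\delta$ is not a remarkably good point for $\vec f$. Then $S$ is stationary in $\lambda^+$.
   Context: For a regular uncountable cardinal $\kappa$ and a cardinal $\mu \geq \kappa$: $P_\kappa(\mu) = \{a \subseteq \mu : |a| < \kappa\}$, and $I_{\kappa,\mu}^+$ is the collection of all $B \subseteq P_\kappa(\mu)$ that are cofinal in $(P_\kappa(\mu), \subseteq)$. A partition of a set $X$ is a set of pairwise disjoint nonempty subsets of $X$ with union $X$. For an infinite cardinal $\tau \leq \kappa$, $PS^+(\tau,\kappa,\mu)$ means: given, for each $a \in P_\kappa(\mu)$, a partition $Q_a$ of $P_\kappa(\mu)$ with $|Q_a| < \tau$, there are $B \in I_{\kappa,\mu}^+$ and $h \in \prod_{a \in P_\kappa(\mu)} Q_a$ such that for any $a, b \in B$, the set $\{c \in h(a) \cap h(b) : a \cup b \subseteq c\}$ is nonempty. An ideal on a set $X$ is a nonempty collection of subsets of $X$,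 closed under subsets and under unions of two members, not containing $X$. Let $A$ be an infinite set of regular cardinals with $|A| < \min A$, and $I$ an ideal on $A$ with $\{A \cap a : a \in A\} \subseteq I$ (where $A \cap a = \{b \in A : b < a\}$). $\prod A = \prod_{a \in A} a$; for $f, g \in \prod A$, $f <_I g$ means $\{a \in A : f(a) \geq g(a)\} \in I$. For a regular cardinal $\pi > \sup A$, $\mathrm{tcf}(\prod A / I) = \pi$ means that there is an increasing, cofinal sequence of length $\pi$ in $(\prod A, <_I)$. Let $\vec f = \langle f_\alpha : \alpha < \pi\rangle$ be such a sequence. An infinite limit ordinal $\delta < \pi$ is a remarkably good point for $\vec f$ if there are a closed unbounded subset $X$ of $\delta$ and $Z_\xi \in I$ for $\xi \in X$ such that $f_\beta(a) < f_\xi(a)$ whenever $\beta < \xi$ are in $X$ and $a \in A \setminus (Z_\beta \cup Z_\xi)$. *)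

theory Defs
  imports Main "HOL-Library.FuncSet" "HOL-Library.Disjoint_Sets" "HOL-Library.Lub_Glb"
begin

unbundle cardinal_syntax

text \<open>
  Ordinals are elements of a type of class \<open>wellorder\<close>; the ordinal \<open>a\<close> is identified with the set
  \<open>{..<a}\<close> of its predecessors, and the order type of the whole type is the ordinal \<open>UNIV\<close>.
  In the definitions below a set argument called \<open>M\<close> stands for an ordinal given in this way, i.e. for
  an initial segment. \<open>ordR M\<close> is that ordinal as a relation, so that the notions \<open>Card_order\<close>,
  \<open>regularCard\<close>, \<open>cardSuc\<close>, \<open>=o\<close>, \<open><o\<close> of the library apply to it.
\<close>

definition ordR :: "'o::wellorder set \<Rightarrow> 'o rel" where
  "ordR M = {(x, y). x \<in> M \<and> y \<in> M \<and> x \<le> y}"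

lemma Field_ordR [simp]: "Field (ordR M) = M"
  by (auto simp: ordR_def Field_def)

lemma Well_order_ordR: "Well_order (ordR (M :: 'o::wellorder set))"
proof -
  have "wf (ordR M - Id)"
    by (rule wf_subset[OF wf]) (auto simp: ordR_def)
  moreover have "linear_order_on M (ordR M)"
    by (auto simp: ordR_def linear_order_on_def partial_order_on_def preorder_on_def
        refl_on_def trans_def antisym_def total_on_def)
  ultimately show ?thesis
    by (simp add: well_order_on_def)
qed

definition cardinal :: "'o::wellorder \<Rightarrow> bool" where
  "cardinal a \<longleftrightarrow> Card_order (ordR {..<a})"

definition regular_cardinal :: "'o::wellorder \<Rightarrow> bool" where
  "regular_cardinal a \<longleftrightarrow> infinite {..<a} \<and> cardinal a \<and> regularCard (ordR {..<a})"

text \<open>Every nonzero limit ordinal is infinite.\<close>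

definition inf_limit :: "'o::wellorder \<Rightarrow> bool" where
  "inf_limit d \<longleftrightarrow> (\<exists>x. x < d) \<and> (\<forall>x<d. \<exists>y. x < y \<and> y < d)"

text \<open>
  The least cardinality of a cofinal subset of \<open>d\<close>; the least \<open>c\<close> with \<open>|X| =o |{..<c}|\<close> is the
  cardinal of \<open>X\<close>.
\<close>

definition cf :: "'o::wellorder \<Rightarrow> 'o" where
  "cf d = (LEAST c. \<exists>X\<subseteq>{..<d}. (\<forall>x<d. \<exists>y\<in>X. x \<le> y) \<and> |X| =o |{..<c}| )"

text \<open>
  The premise of the last conjunct of \<open>club_in\<close> says that \<open>g\<close> is a nonzero limit ordinal and
  \<open>X \<inter> {..<g}\<close> is unbounded in \<open>g\<close>.
\<close>

definition club_in :: "'o::wellorder set \<Rightarrow> 'o set \<Rightarrow> bool" where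
  "club_in M X \<longleftrightarrow> X \<subseteq> M \<and> (\<forall>x\<in>M. \<exists>y\<in>X. x \<le> y) \<and>
     (\<forall>g\<in>M. (\<exists>x. x < g) \<and> (\<forall>x<g. \<exists>y\<in>X. x < y \<and> y < g) \<longrightarrow> g \<in> X)"

definition stationary_in :: "'o::wellorder set \<Rightarrow> 'o set \<Rightarrow> bool" where
  "stationary_in M S \<longleftrightarrow> S \<subseteq> M \<and> (\<forall>C. club_in M C \<longrightarrow> S \<inter> C \<noteq> {})"

definition Pset :: "'k rel \<Rightarrow> 'm set \<Rightarrow> 'm set set" where
  "Pset \<kappa> M = {a. a \<subseteq> M \<and> |a| <o \<kappa>}"

definition Iplus :: "'k rel \<Rightarrow> 'm set \<Rightarrow> 'm set set set" where
  "Iplus \<kappa> M = {B. B \<subseteq> Pset \<kappa> M \<and> (\<forall>a\<in>Pset \<kappa> M. \<exists>b\<in>B. a \<subseteq> b)}"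

text \<open>
  Only meant for infinite cardinals \<open>\<tau> \<le> \<kappa>\<close>, with \<open>\<kappa>\<close> regular uncountable and \<open>M\<close> a cardinal at least \<open>\<kappa>\<close>.
\<close>

definition PSplus :: "'t rel \<Rightarrow> 'k rel \<Rightarrow> 'm set \<Rightarrow> bool" where
  "PSplus \<tau> \<kappa> M \<longleftrightarrow>
     (\<forall>Q :: 'm set \<Rightarrow> 'm set set set.
        (\<forall>a\<in>Pset \<kappa> M. partition_on (Pset \<kappa> M) (Q a) \<and> |Q a| <o \<tau>) \<longrightarrow>
        (\<exists>B\<in>Iplus \<kappa> M. \<exists>h \<in> (\<Pi>\<^sub>E a\<in>Pset \<kappa> M. Q a).
           \<forall>a\<in>B. \<forall>b\<in>B. {c \<in> h a \<inter> h b. a \<union> b \<subseteq> c} \<noteq> {}))"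

definition ideal_on :: "'a set \<Rightarrow> 'a set set \<Rightarrow> bool" where
  "ideal_on X I \<longleftrightarrow> I \<noteq> {} \<and> I \<subseteq> Pow X \<and> X \<notin> I \<and>
     (\<forall>Y\<in>I. \<forall>Z. Z \<subseteq> Y \<longrightarrow> Z \<in> I) \<and> (\<forall>Y\<in>I. \<forall>Z\<in>I. Y \<union> Z \<in> I)"

definition prod_ord :: "'o::wellorder set \<Rightarrow> ('o \<Rightarrow> 'o) set" where
  "prod_ord A = (\<Pi>\<^sub>E a\<in>A. {..<a})"

definition less_mod :: "'o::wellorder set \<Rightarrow> 'o set set \<Rightarrow> ('o \<Rightarrow> 'o) \<Rightarrow> ('o \<Rightarrow> 'o) \<Rightarrow> bool" where
  "less_mod A I f g \<longleftrightarrow> {a\<in>A. f a \<ge> g a} \<in> I"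

definition inc_cofinal_seq ::
    "'o::wellorder set \<Rightarrow> 'o set set \<Rightarrow> 'o set \<Rightarrow> ('o \<Rightarrow> 'o \<Rightarrow> 'o) \<Rightarrow> bool" where
  "inc_cofinal_seq A I M f \<longleftrightarrow>
     (\<forall>\<alpha>\<in>M. f \<alpha> \<in> prod_ord A) \<and>
     (\<forall>\<alpha>\<in>M. \<forall>\<beta>\<in>M. \<alpha> < \<beta> \<longrightarrow> less_mod A I (f \<alpha>) (f \<beta>)) \<and>
     (\<forall>g\<in>prod_ord A. \<exists>\<alpha>\<in>M. less_mod A I g (f \<alpha>))"

text \<open>Only meant for \<open>M\<close> a regular cardinal greater than \<open>sup A\<close>.\<close>

definition tcf_is :: "'o::wellorder set \<Rightarrow> 'o set set \<Rightarrow> 'o set \<Rightarrow> bool" where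
  "tcf_is A I M \<longleftrightarrow> (\<exists>f. inc_cofinal_seq A I M f)"

definition remarkably_good ::
    "'o::wellorder set \<Rightarrow> 'o set set \<Rightarrow> ('o \<Rightarrow> 'o \<Rightarrow> 'o) \<Rightarrow> 'o \<Rightarrow> bool" where
  "remarkably_good A I f d \<longleftrightarrow> inf_limit d \<and>
     (\<exists>X Z. club_in {..<d} X \<and> (\<forall>\<xi>\<in>X. Z \<xi> \<in> I) \<and>
        (\<forall>\<beta>\<in>X. \<forall>\<xi>\<in>X. \<beta> < \<xi> \<longrightarrow> (\<forall>a\<in>A - (Z \<beta> \<union> Z \<xi>). f \<beta> a < f \<xi> a)))"

end

theory Submission
  imports Defs
begin

text \<open>
  Suppose \<open>S\<close> is not stationary, and let \<open>C\<close> be a club of \<open>\<lambda>\<^sup>+\<close> all of whose limit ordinals of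
  cofinality less than \<open>\<kappa>\<close> are remarkably good. The contradiction is a single coordinate \<open>t \<in> A\<close> at
  which \<open>f\<close> is strictly increasing along a cofinal subset of \<open>\<lambda>\<^sup>+\<close>: such a subset has \<open>\<lambda>\<^sup>+\<close> elements,
  whereas the values lie below \<open>t \<le> \<lambda>\<close>.

  Remarkable goodness of \<open>\<delta>\<close> makes \<open>f\<close> pointwise increasing on a club of \<open>\<delta>\<close>, up to one set of \<open>I\<close> for
  each index. If it holds at every limit point of a set \<open>D\<close>, then an induction along \<open>D\<close> that refines
  the gaps of these clubs gives the same for all of \<open>D\<close> (\<open>increasing_off_below\<close>). This applies when
  \<open>D\<close> consists of the points \<open>\<zeta> a\<close> for \<open>a \<subseteq> c\<close>, where \<open>c\<close> has size less than \<open>\<kappa>\<close> and \<open>\<zeta> a\<close> is the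
  least member of \<open>C\<close> that bounds \<open>a\<close>: the limit points of \<open>D\<close> lie in \<open>C\<close> because \<open>D \<subseteq> C\<close>, and have
  cofinality less than \<open>\<kappa>\<close> because the \<open>\<zeta> {y}\<close> for \<open>y \<in> c\<close> are cofinal below each of them.

  Choose for each \<open>a \<subseteq> c\<close> a coordinate outside the exceptional set of \<open>\<zeta> a\<close>; if \<open>a, b \<subseteq> c\<close> receive the same coordinate \<open>t\<close> and \<open>\<zeta> a < \<zeta> b\<close>, then
  \<open>f (\<zeta> a) t < f (\<zeta> b) t\<close>. For fixed \<open>a\<close> the coordinate is a colouring of the sets \<open>c\<close> with \<open>|A|\<close>
  colours, so \<open>PS\<^sup>+\<close> assigns to each member of a cofinal family a colour in such a way that any two
  members \<open>a\<close>, \<open>b\<close> have a common \<open>c\<close> realizing both of their colours. As \<open>\<lambda>\<^sup>+\<close> is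
  regular, one colour \<open>t\<close> is used cofinally often.
\<close>

section \<open>Sequences that increase outside sets of the ideal\<close>

definition increasing_off ::
    "'a set \<Rightarrow> 'a set set \<Rightarrow> ('i::linorder \<Rightarrow> 'a \<Rightarrow> 'v::linorder) \<Rightarrow> 'i set \<Rightarrow> ('i \<Rightarrow> 'a set) \<Rightarrow> bool" where
  "increasing_off A I f D Z \<longleftrightarrow> (\<forall>\<xi>\<in>D. Z \<xi> \<in> I) \<and>
     (\<forall>\<beta>\<in>D. \<forall>\<xi>\<in>D. \<beta> < \<xi> \<longrightarrow> (\<forall>a\<in>A - (Z \<beta> \<union> Z \<xi>). f \<beta> a < f \<xi> a))"

text \<open>
  The new top point needs no exceptional set of its own: each earlier point absorbs the
  coordinates at which it fails to lie below the top.
\<close>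

lemma increasing_off_insert_top:
  assumes I: "ideal_on A I"
    and Z: "increasing_off A I f D Z"
    and top: "\<And>\<alpha>. \<alpha> \<in> D \<Longrightarrow> \<alpha> < x \<and> less_mod A I (f \<alpha>) (f x)"
  shows "\<exists>Z'. increasing_off A I f (insert x D) Z'"
proof
  let ?Z = "\<lambda>\<alpha>. if \<alpha> = x then {} else Z \<alpha> \<union> {a\<in>A. f \<alpha> a \<ge> f x a}"
  have "{} \<in> I"
    using I by (auto simp: ideal_on_def)
  then have "\<forall>\<xi>\<in>insert x D. ?Z \<xi> \<in> I"
    using I Z top by (auto simp: ideal_on_def increasing_off_def less_mod_def)
  moreover have "f \<beta> a < f \<xi> a"
    if "\<beta> \<in> insert x D" "\<xi> \<in> insert x D" "\<beta> < \<xi>" "a \<in> A - (?Z \<beta> \<union> ?Z \<xi>)" for \<beta> \<xi> a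
  proof (cases "\<xi> = x")
    case True
    then show ?thesis
      using that by (auto split: if_splits)
  next
    case False
    then have "\<beta> \<in> D" "\<xi> \<in> D" "a \<in> A - (Z \<beta> \<union> Z \<xi>)"
      using that top[of \<xi>] by (auto split: if_splits)
    then show ?thesis
      using Z \<open>\<beta> < \<xi>\<close> by (auto simp: increasing_off_def)
  qed
  ultimately show "increasing_off A I f (insert x D) ?Z"
    unfolding increasing_off_def by blast
qed

text \<open>The least upper bound of \<open>X \<inter> {..\<alpha>}\<close> is a limit of \<open>X\<close> below \<open>\<delta>\<close> unless it is attained.\<close>

lemma club_in_greatest_below:
  fixes X :: "'o::wellorder set"
  assumes X: "club_in {..<\<delta>} X" and "\<alpha> < \<delta>" and "X \<inter> {..\<alpha>} \<noteq> {}"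
  shows "\<exists>\<gamma>\<in>X. \<gamma> \<le> \<alpha> \<and> (\<forall>y\<in>X. y \<le> \<alpha> \<longrightarrow> y \<le> \<gamma>)"
proof -
  define \<gamma> where "\<gamma> = (LEAST g. \<forall>y\<in>X. y \<le> \<alpha> \<longrightarrow> y \<le> g)"
  have ub: "\<forall>y\<in>X. y \<le> \<alpha> \<longrightarrow> y \<le> \<gamma>"
    unfolding \<gamma>_def by (rule LeastI[of _ \<alpha>]) auto
  have le: "\<gamma> \<le> \<alpha>"
    unfolding \<gamma>_def by (rule Least_le) auto
  have "\<gamma> \<in> X"
  proof (rule ccontr)
    assume notin: "\<gamma> \<notin> X"
    have "\<exists>y\<in>X. x < y \<and> y < \<gamma>" if "x < \<gamma>" for x
    proof -
      have "\<not> (\<forall>y\<in>X. y \<le> \<alpha> \<longrightarrow> y \<le> x)"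
        using that not_less_Least unfolding \<gamma>_def by blast
      then obtain y where "y \<in> X" "y \<le> \<alpha>" "x < y"
        by auto
      then show ?thesis
        using ub notin by (metis order_le_less)
    qed
    moreover have "\<exists>x. x < \<gamma>"
      using assms(3) ub notin by (metis IntE atMost_iff ex_in_conv order_le_less)
    ultimately show False
      using X notin le \<open>\<alpha> < \<delta>\<close> unfolding club_in_def by auto
  qed
  then show ?thesis
    using ub le by blast
qed

text \<open>
  Solutions on the gaps of the club of a remarkably good \<open>\<delta>\<close> are glued as follows. Let \<open>\<alpha>\<close> lie in the
  gap from \<open>\<gamma>\<close> to the next club point \<open>\<eta>\<close> (there is no \<open>\<gamma>\<close> below the least point of the club).
  Besides the coordinates excluded within the gap, exclude those excluded by \<open>\<gamma>\<close> and \<open>\<eta>\<close>, and those at which \<open>f \<gamma> \<le> f \<alpha> < f \<eta>\<close> may fail. These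
  are finitely many members of \<open>I\<close>, and points of different gaps are then compared through the club.
\<close>

lemma increasing_off_glue:
  fixes f :: "'o::wellorder \<Rightarrow> 'o \<Rightarrow> 'o"
  assumes I: "ideal_on A I"
    and inc: "\<And>\<alpha> \<beta>. \<alpha> < \<beta> \<Longrightarrow> less_mod A I (f \<alpha>) (f \<beta>)"
    and good: "remarkably_good A I f \<delta>"
    and gaps: "\<And>\<eta>. \<eta> < \<delta> \<Longrightarrow> \<exists>Z. increasing_off A I f (D \<inter> {..<\<eta>}) Z"
  shows "\<exists>Z. increasing_off A I f (D \<inter> {..<\<delta>}) Z"
proof -
  obtain X W where X: "club_in {..<\<delta>} X" and W: "increasing_off A I f X W"
    using good unfolding remarkably_good_def increasing_off_def by auto
  have lim: "inf_limit \<delta>"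
    using good by (simp add: remarkably_good_def)
  obtain G where G: "\<And>\<eta>. \<eta> < \<delta> \<Longrightarrow> increasing_off A I f (D \<inter> {..<\<eta>}) (G \<eta>)"
    using gaps by metis
  define next_pt where "next_pt \<alpha> = (LEAST \<eta>. \<eta> \<in> X \<and> \<alpha> < \<eta>)" for \<alpha>
  define bad where "bad \<alpha> \<beta> = {a\<in>A. f \<alpha> a \<ge> f \<beta> a}" for \<alpha> \<beta>
  have "\<exists>\<gamma>. X \<inter> {..\<alpha>} \<noteq> {} \<longrightarrow> \<gamma> \<in> X \<and> \<gamma> \<le> \<alpha> \<and> (\<forall>y\<in>X. y \<le> \<alpha> \<longrightarrow> y \<le> \<gamma>)"
    if "\<alpha> < \<delta>" for \<alpha>
    using club_in_greatest_below[OF X that] by blast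
  then obtain prev where prev:
    "\<And>\<alpha>. \<alpha> < \<delta> \<Longrightarrow> X \<inter> {..\<alpha>} \<noteq> {} \<Longrightarrow>
      prev \<alpha> \<in> X \<and> prev \<alpha> \<le> \<alpha> \<and> (\<forall>y\<in>X. y \<le> \<alpha> \<longrightarrow> y \<le> prev \<alpha>)"
    by metis
  have next_pt: "next_pt \<alpha> \<in> X \<and> \<alpha> < next_pt \<alpha>" if "\<alpha> < \<delta>" for \<alpha>
  proof -
    obtain y where "\<alpha> < y" "y < \<delta>"
      using lim \<open>\<alpha> < \<delta>\<close> by (auto simp: inf_limit_def)
    then obtain \<eta> where "\<eta> \<in> X" "\<alpha> < \<eta>"
      using X unfolding club_in_def by (meson lessThan_iff order_less_le_trans)
    then show ?thesis
      unfolding next_pt_def by (metis (mono_tags, lifting) LeastI)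
  qed
  have X_below: "\<eta> < \<delta>" if "\<eta> \<in> X" for \<eta>
    using X that by (auto simp: club_in_def)
  have empty: "{} \<in> I" and union: "\<And>U V. U \<in> I \<Longrightarrow> V \<in> I \<Longrightarrow> U \<union> V \<in> I"
    using I by (auto simp: ideal_on_def)
  have bad: "bad \<alpha> \<beta> \<in> I" if "\<alpha> < \<beta>" for \<alpha> \<beta>
    using inc[OF that] by (simp add: bad_def less_mod_def)
  define Z where "Z \<alpha> = G (next_pt \<alpha>) \<alpha> \<union> W (next_pt \<alpha>) \<union> bad \<alpha> (next_pt \<alpha>) \<union>
    (if X \<inter> {..\<alpha>} = {} then {}
     else W (prev \<alpha>) \<union> (if prev \<alpha> < \<alpha> then bad (prev \<alpha>) \<alpha> else {}))" for \<alpha>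
  have Z_in: "Z \<alpha> \<in> I" if "\<alpha> \<in> D" "\<alpha> < \<delta>" for \<alpha>
  proof -
    have "G (next_pt \<alpha>) \<alpha> \<in> I"
      using G[of "next_pt \<alpha>"] next_pt[of \<alpha>] X_below that by (auto simp: increasing_off_def)
    moreover have "\<And>\<xi>. \<xi> \<in> X \<Longrightarrow> W \<xi> \<in> I"
      using W by (auto simp: increasing_off_def)
    ultimately show ?thesis
      using next_pt[OF \<open>\<alpha> < \<delta>\<close>] prev[OF \<open>\<alpha> < \<delta>\<close>]
      unfolding Z_def by (auto intro!: union bad empty)
  qed
  have "f \<alpha> a < f \<beta> a"
    if \<alpha>\<beta>: "\<alpha> \<in> D" "\<beta> \<in> D" "\<beta> < \<delta>" "\<alpha> < \<beta>" and a: "a \<in> A" "a \<notin> Z \<alpha>" "a \<notin> Z \<beta>" for \<alpha> \<beta> a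
  proof (cases "\<beta> < next_pt \<alpha>")
    case True
    have "\<alpha> < \<delta>"
      using \<alpha>\<beta> by simp
    have "next_pt \<beta> = next_pt \<alpha>"
    proof (rule antisym)
      show "next_pt \<beta> \<le> next_pt \<alpha>"
        unfolding next_pt_def[of \<beta>] using next_pt[OF \<open>\<alpha> < \<delta>\<close>] True by (intro Least_le) auto
      show "next_pt \<alpha> \<le> next_pt \<beta>"
        unfolding next_pt_def[of \<alpha>] using next_pt[OF \<open>\<beta> < \<delta>\<close>] \<alpha>\<beta> by (intro Least_le) auto
    qed
    then show ?thesis
      using G[of "next_pt \<alpha>"] next_pt[OF \<open>\<alpha> < \<delta>\<close>] X_below True \<alpha>\<beta> a
      unfolding increasing_off_def Z_def by auto
  next
    case False
    have "\<alpha> < \<delta>"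
      using \<alpha>\<beta> by simp
    have \<eta>: "next_pt \<alpha> \<in> X" "next_pt \<alpha> \<le> \<beta>"
      using next_pt[OF \<open>\<alpha> < \<delta>\<close>] False by auto
    then have ne: "X \<inter> {..\<beta>} \<noteq> {}"
      by auto
    note \<gamma> = prev[OF \<open>\<beta> < \<delta>\<close> ne]
    have "f \<alpha> a < f (next_pt \<alpha>) a"
      using a by (auto simp: Z_def bad_def)
    also have "\<dots> \<le> f (prev \<beta>) a"
    proof (cases "next_pt \<alpha> = prev \<beta>")
      case False
      then have "next_pt \<alpha> < prev \<beta>"
        using \<gamma> \<eta> by (simp add: order_less_le)
      moreover have "a \<in> A - (W (next_pt \<alpha>) \<union> W (prev \<beta>))"
        using a ne by (auto simp: Z_def)
      ultimately show ?thesis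
        using W \<gamma> \<eta> unfolding increasing_off_def by (meson order_less_imp_le)
    qed simp
    also have "\<dots> \<le> f \<beta> a"
    proof (cases "prev \<beta> = \<beta>")
      case False
      then have "prev \<beta> < \<beta>"
        using \<gamma> by (simp add: order_less_le)
      then show ?thesis
        using a ne by (auto simp: Z_def bad_def)
    qed simp
    finally show ?thesis .
  qed
  then have "increasing_off A I f (D \<inter> {..<\<delta>}) Z"
    using Z_in unfolding increasing_off_def by auto
  then show ?thesis by blast
qed

text \<open>
  At a limit point of \<open>D\<close> the gluing applies; below any other point, \<open>D\<close> ends in a last point
  (or is empty), which is added on top.
\<close>

lemma increasing_off_below:
  fixes f :: "'o::wellorder \<Rightarrow> 'o \<Rightarrow> 'o"
  assumes I: "ideal_on A I"
    and inc: "\<And>\<alpha> \<beta>. \<alpha> < \<beta> \<Longrightarrow> less_mod A I (f \<alpha>) (f \<beta>)"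
    and good: "\<And>\<delta>. \<exists>x. x < \<delta> \<Longrightarrow> \<forall>x<\<delta>. \<exists>y\<in>D. x < y \<and> y < \<delta> \<Longrightarrow> remarkably_good A I f \<delta>"
  shows "\<exists>Z. increasing_off A I f (D \<inter> {..<\<delta>}) Z"
proof (induction \<delta> rule: less_induct)
  case (less \<delta>)
  show ?case
  proof (cases "\<forall>x<\<delta>. \<exists>y\<in>D. x < y \<and> y < \<delta>")
    case True
    show ?thesis
    proof (cases "\<exists>x. x < \<delta>")
      case ex: True
      show ?thesis
        by (rule increasing_off_glue[OF I inc good[OF ex True] less.IH])
    next
      case False
      then have "D \<inter> {..<\<delta>} = {}"
        by auto
      then show ?thesis
        by (simp add: increasing_off_def)
    qed
  next
    case False
    then obtain x where x: "x < \<delta>" "\<And>y. y \<in> D \<Longrightarrow> y < \<delta> \<Longrightarrow> y \<le> x"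
      by (meson not_le)
    obtain Z where Z: "increasing_off A I f (D \<inter> {..<x}) Z"
      using less.IH[OF x(1)] by blast
    have "\<exists>Z'. increasing_off A I f (insert x (D \<inter> {..<x})) Z'"
      by (rule increasing_off_insert_top[OF I Z]) (simp add: inc)
    then obtain Z' where Z': "increasing_off A I f (insert x (D \<inter> {..<x})) Z'" ..
    have sub: "D \<inter> {..<\<delta>} \<subseteq> insert x (D \<inter> {..<x})"
      using x(2) order_less_le by fastforce
    have "increasing_off A I f (D \<inter> {..<\<delta>}) Z'"
      using Z' subsetD[OF sub] unfolding increasing_off_def by blast
    then show ?thesis by blast
  qed
qed

section \<open>Small sets of ordinals\<close>

lemma unbounded_regularCard:
  assumes "regularCard (ordR (UNIV :: 'o::wellorder set))"
    and "\<forall>x::'o. \<exists>y\<in>K. x < y"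
  shows "|K| =o ordR (UNIV :: 'o set)"
proof -
  have "\<exists>y\<in>K. x \<noteq> y \<and> (x, y) \<in> ordR UNIV" for x :: 'o
  proof -
    obtain y where "y \<in> K" "x < y"
      using assms(2) by blast
    then show ?thesis
      unfolding ordR_def by (intro bexI[of _ y]) auto
  qed
  then have "cofinal K (ordR UNIV)"
    by (simp add: cofinal_def)
  then show ?thesis
    using assms(1) by (simp add: regularCard_def)
qed

lemma bounded_if_small:
  assumes "regularCard (ordR (UNIV :: 'o::wellorder set))"
    and "|K| <o ordR (UNIV :: 'o set)"
  shows "\<exists>u. \<forall>x\<in>K. x \<le> (u::'o)"
proof (rule ccontr)
  assume "\<not> ?thesis"
  then have "|K| =o ordR (UNIV :: 'o set)"
    using unbounded_regularCard[OF assms(1)] by (metis not_le)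
  then show False
    using assms(2) not_ordLess_ordIso by blast
qed

lemma cf_less_if_small_cofinal:
  fixes \<kappa> \<delta> :: "'o::wellorder"
  assumes small: "|X| <o ordR {..<\<kappa>}"
    and X: "X \<subseteq> {..<\<delta>}" "\<forall>x<\<delta>. \<exists>y\<in>X. x \<le> y"
  shows "cf \<delta> < \<kappa>"
proof -
  have "\<exists>\<nu>\<in>Field (ordR {..<\<kappa>}). |X| =o Restr (ordR {..<\<kappa>}) (underS (ordR {..<\<kappa>}) \<nu>)"
    using small ordLess_iff_ordIso_Restr[OF Well_order_ordR card_of_Well_order] by blast
  then obtain \<nu> where \<nu>: "\<nu> < \<kappa>"
      and iso: "|X| =o Restr (ordR {..<\<kappa>}) (underS (ordR {..<\<kappa>}) \<nu>)"
    by auto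
  have eq: "Field (Restr (ordR {..<\<kappa>}) (underS (ordR {..<\<kappa>}) \<nu>)) = {..<\<nu>}"
  proof -
    have "Restr (ordR {..<\<kappa>}) (underS (ordR {..<\<kappa>}) \<nu>) = ordR {..<\<nu>}"
      using \<nu> by (auto simp: underS_def ordR_def)
    then show ?thesis
      by simp
  qed
  have "|X| =o |{..<\<nu>}|"
    using card_of_cong[OF iso] unfolding eq by (simp add: Field_card_of)
  then have "cf \<delta> \<le> \<nu>"
    unfolding cf_def using X by (intro Least_le) auto
  then show ?thesis
    using \<nu> by simp
qed

section \<open>Partitions from colourings\<close>

text \<open>
  \<open>PS\<^sup>+\<close> in the form in which it is used: each \<open>a\<close> colours \<open>P\<^sub>\<kappa>(M)\<close>, and the values of \<open>h\<close> are colour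
  classes, so they can be replaced by colours.
\<close>

lemma PSplus_colouring:
  fixes col :: "'m set \<Rightarrow> 'm set \<Rightarrow> 'a"
  assumes PS: "PSplus (cardSuc |A| ) \<kappa> M"
    and col: "\<And>a c. col a c \<in> A"
  obtains B t where "B \<in> Iplus \<kappa> M" "\<And>a. a \<in> B \<Longrightarrow> t a \<in> A"
    "\<And>a b. a \<in> B \<Longrightarrow> b \<in> B \<Longrightarrow> \<exists>c. a \<subseteq> c \<and> b \<subseteq> c \<and> c \<in> Pset \<kappa> M \<and> col a c = t a \<and> col b c = t b"
proof -
  define cls where "cls a t = {c \<in> Pset \<kappa> M. col a c = t}" for a t
  define Q where "Q a = cls a ` A - {{}}" for a
  have "partition_on (Pset \<kappa> M) (Q a)" for a
    unfolding partition_on_def disjoint_def Q_def cls_def using col by auto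
  moreover have "|Q a| <o cardSuc |A|" for a
  proof -
    have "|Q a| \<le>o |cls a ` A|"
      unfolding Q_def by (rule card_of_mono1) auto
    also have "|cls a ` A| \<le>o |A|"
      by (rule card_of_image)
    also have "|A| <o cardSuc |A|"
      by (rule cardSuc_greater) (rule card_of_Card_order)
    finally show ?thesis .
  qed
  ultimately have "\<exists>B\<in>Iplus \<kappa> M. \<exists>h \<in> (\<Pi>\<^sub>E a\<in>Pset \<kappa> M. Q a).
      \<forall>a\<in>B. \<forall>b\<in>B. {c \<in> h a \<inter> h b. a \<union> b \<subseteq> c} \<noteq> {}"
    by (intro PS[unfolded PSplus_def, THEN spec, THEN mp]) simp
  then obtain B h where B: "B \<in> Iplus \<kappa> M" and h: "h \<in> (\<Pi>\<^sub>E a\<in>Pset \<kappa> M. Q a)"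
    and meet: "\<forall>a\<in>B. \<forall>b\<in>B. {c \<in> h a \<inter> h b. a \<union> b \<subseteq> c} \<noteq> {}"
    by blast
  have "\<exists>t\<in>A. h a = cls a t" if "a \<in> B" for a
    using h B that unfolding Iplus_def Q_def by (auto dest!: PiE_mem)
  then obtain t where t: "\<And>a. a \<in> B \<Longrightarrow> t a \<in> A \<and> h a = cls a (t a)"
    by metis
  show thesis
  proof
    show "B \<in> Iplus \<kappa> M" by fact
    show "t a \<in> A" if "a \<in> B" for a
      using t that by blast
    show "\<exists>c. a \<subseteq> c \<and> b \<subseteq> c \<and> c \<in> Pset \<kappa> M \<and> col a c = t a \<and> col b c = t b"
      if ab: "a \<in> B" "b \<in> B" for a b
    proof -
      obtain c where "c \<in> h a" "c \<in> h b" "a \<union> b \<subseteq> c"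
        using meet ab by blast
      then show ?thesis
        using t[OF ab(1)] t[OF ab(2)] by (auto simp: cls_def)
    qed
  qed
qed

section \<open>Stationarity\<close>

theorem proposition2p15:
  fixes \<kappa> lam :: "'o::wellorder"
    and A :: "'o set" and I :: "'o set set"
    and f :: "'o \<Rightarrow> 'o \<Rightarrow> 'o"
  assumes "cardinal lam"
    and "ordR (UNIV :: 'o set) =o cardSuc (ordR {..<lam})"
    and "regular_cardinal \<kappa>" and "natLeq <o ordR {..<\<kappa>}" and "\<kappa> \<le> lam"
    and "infinite A" and "\<forall>a\<in>A. regular_cardinal a"
    and "|A| <o ordR {..<\<kappa>}" and "\<forall>a\<in>A. |A| <o ordR {..<a}"
    and "isLub UNIV A lam"
    and "ideal_on A I" and "(\<lambda>a. A \<inter> {..<a}) ` A \<subseteq> I"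
    and "tcf_is A I UNIV"
    and "PSplus (cardSuc |A| ) (ordR {..<\<kappa>}) (UNIV :: 'o set)"
    and "inc_cofinal_seq A I UNIV f"
  shows "stationary_in UNIV {\<delta>. inf_limit \<delta> \<and> cf \<delta> < \<kappa> \<and> \<not> remarkably_good A I f \<delta>}"
proof (rule ccontr)
  assume "\<not> ?thesis"
  then obtain C where C: "club_in UNIV C"
    and C_good: "\<And>\<delta>. \<delta> \<in> C \<Longrightarrow> inf_limit \<delta> \<Longrightarrow> cf \<delta> < \<kappa> \<Longrightarrow> remarkably_good A I f \<delta>"
    unfolding stationary_in_def by blast

  have lam_card: "Card_order (ordR {..<lam})"
    using assms(1) by (simp add: cardinal_def)
  have \<kappa>_inf: "infinite {..<\<kappa>}" and \<kappa>_card: "Card_order (ordR {..<\<kappa>})"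
    using assms(3) by (auto simp: regular_cardinal_def cardinal_def)
  have lam_inf: "infinite {..<lam}"
    using \<kappa>_inf \<open>\<kappa> \<le> lam\<close> by (meson finite_subset lessThan_subset_iff)
  have lam_iso: "|{..<lam}| =o ordR {..<lam}" and \<kappa>_iso: "|{..<\<kappa>}| =o ordR {..<\<kappa>}"
    using card_of_Field_ordIso[OF lam_card] card_of_Field_ordIso[OF \<kappa>_card] by simp_all
  have lam_less: "|{..<lam}| <o ordR (UNIV :: 'o set)"
    using lam_iso cardSuc_greater[OF lam_card] assms(2)
    by (meson ordIso_ordLess_trans ordIso_symmetric ordLess_ordIso_trans)
  have reg: "regularCard (ordR (UNIV :: 'o set))"
  proof (rule regularCard_ordIso[OF ordIso_symmetric[OF assms(2)]])
    show "Cinfinite (cardSuc (ordR {..<lam}))"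
      using lam_card lam_inf by (intro Cinfinite_cardSuc) (simp add: cinfinite_def)
    show "regularCard (cardSuc (ordR {..<lam}))"
      using lam_card lam_inf by (intro regularCard_cardSuc) (simp add: cinfinite_def)
  qed
  have \<kappa>_less: "ordR {..<\<kappa>} <o ordR (UNIV :: 'o set)"
  proof -
    have "|{..<\<kappa>}| \<le>o |{..<lam}|"
      using \<open>\<kappa> \<le> lam\<close> by (intro card_of_mono1) auto
    then show ?thesis
      using \<kappa>_iso lam_less
      by (meson ordIso_ordLess_trans ordIso_symmetric ordLeq_ordLess_trans)
  qed
  have bounded: "\<exists>u. \<forall>x\<in>K. x \<le> u" if "|K| <o ordR {..<\<kappa>}" for K :: "'o set"
    using bounded_if_small[OF reg ordLess_transitive[OF that \<kappa>_less]] .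
  have singleton_small: "|{v}| <o ordR {..<\<kappa>}" for v :: 'o
    using finite_ordLess_infinite[OF card_of_Well_order Well_order_ordR, of "{v}" "{..<\<kappa>}"] \<kappa>_inf
    by (simp add: Field_card_of)
  have no_max: "\<exists>y. x < y" for x :: 'o
  proof -
    have "Card_order (ordR (UNIV :: 'o set))"
      by (rule Card_order_ordIso[OF cardSuc_Card_order[OF lam_card] assms(2)])
    moreover have "infinite (Field (ordR (UNIV :: 'o set)))"
      using lam_inf by (metis Field_ordR finite_subset subset_UNIV)
    ultimately have "\<exists>y\<in>Field (ordR (UNIV :: 'o set)). x \<noteq> y \<and> (x, y) \<in> ordR UNIV"
      by (rule infinite_Card_order_limit) simp
    then show ?thesis
      by (auto simp: ordR_def order_less_le)
  qed

  have inc: "less_mod A I (f \<alpha>) (f \<beta>)" if "\<alpha> < \<beta>" for \<alpha> \<beta>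
    using assms(15) that by (auto simp: inc_cofinal_seq_def)

  define \<zeta> where "\<zeta> a = (LEAST z. z \<in> C \<and> (\<forall>x\<in>a. x \<le> z))" for a
  have \<zeta>: "\<zeta> a \<in> C \<and> (\<forall>x\<in>a. x \<le> \<zeta> a)" if small: "|a| <o ordR {..<\<kappa>}" for a
  proof -
    obtain u where "\<forall>x\<in>a. x \<le> u"
      using bounded[OF small] by blast
    moreover obtain z where "z \<in> C" "u \<le> z"
      using C unfolding club_in_def by blast
    ultimately have "z \<in> C \<and> (\<forall>x\<in>a. x \<le> z)"
      by auto
    then show ?thesis
      unfolding \<zeta>_def by (rule LeastI)
  qed
  have \<zeta>_le: "\<zeta> a \<le> z" if "z \<in> C" "\<forall>x\<in>a. x \<le> z" for a z
    unfolding \<zeta>_def using that by (intro Least_le) auto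

  have "\<exists>Z. increasing_off A I f (\<zeta> ` Pow c) Z" if c: "|c| <o ordR {..<\<kappa>}" for c
  proof -
    have sub_small: "|a| <o ordR {..<\<kappa>}" if "a \<subseteq> c" for a
      using card_of_mono1[OF that] c by (rule ordLeq_ordLess_trans)
    have good: "remarkably_good A I f \<delta>"
      if ex: "\<exists>x. x < \<delta>" and lim: "\<forall>x<\<delta>. \<exists>y\<in>\<zeta> ` Pow c. x < y \<and> y < \<delta>" for \<delta>
    proof (rule C_good)
      have "\<zeta> ` Pow c \<subseteq> C"
        using \<zeta> sub_small by auto
      then have "\<forall>x<\<delta>. \<exists>y\<in>C. x < y \<and> y < \<delta>"
        using lim by blast
      then show "\<delta> \<in> C"
        using C ex unfolding club_in_def by blast
      show "inf_limit \<delta>"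
        using ex lim by (auto simp: inf_limit_def)
      \<comment> \<open>If \<open>\<zeta> a < \<zeta> b\<close>, then \<open>\<zeta> a < \<zeta> {y} \<le> \<zeta> b\<close> for some \<open>y \<in> b\<close>, so the points coming from
        singletons are already cofinal in \<open>\<delta>\<close>; there are at most \<open>|c|\<close> of them.\<close>
      let ?X = "(\<lambda>y. \<zeta> {y}) ` c \<inter> {..<\<delta>}"
      show "cf \<delta> < \<kappa>"
      proof (rule cf_less_if_small_cofinal)
        have "|?X| \<le>o |(\<lambda>y. \<zeta> {y}) ` c|"
          by (rule card_of_mono1) auto
        also have "|(\<lambda>y. \<zeta> {y}) ` c| \<le>o |c|"
          by (rule card_of_image)
        finally show "|?X| <o ordR {..<\<kappa>}"
          using c by (rule ordLeq_ordLess_trans)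
        show "\<forall>x<\<delta>. \<exists>y\<in>?X. x \<le> y"
        proof (intro allI impI)
          fix x assume "x < \<delta>"
          then obtain a where a: "a \<subseteq> c" "x < \<zeta> a" "\<zeta> a < \<delta>"
            using lim by blast
          then obtain b where b: "b \<subseteq> c" "\<zeta> a < \<zeta> b" "\<zeta> b < \<delta>"
            using lim by blast
          then obtain y where y: "y \<in> b" "\<zeta> a < y"
            using \<zeta>_le[of "\<zeta> a" b] \<zeta>[OF sub_small[OF a(1)]] by (meson not_le)
          have "\<zeta> {y} \<le> \<zeta> b"
            using \<zeta>_le[of "\<zeta> b" "{y}"] \<zeta>[OF sub_small[OF b(1)]] y by auto
          moreover have "y \<le> \<zeta> {y}"
            using \<zeta>[OF singleton_small] by auto
          ultimately have "\<zeta> {y} \<in> ?X" "x \<le> \<zeta> {y}"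
            using a b y by auto
          then show "\<exists>y\<in>?X. x \<le> y"
            by blast
        qed
      qed auto
    qed
    obtain \<beta> where \<beta>: "\<zeta> c < \<beta>"
      using no_max by blast
    have "\<zeta> a < \<beta>" if "a \<subseteq> c" for a
      using \<zeta>_le[of "\<zeta> c" a] \<zeta>[OF c] that \<beta> by (meson order_le_less_trans subsetD)
    then have eq: "\<zeta> ` Pow c \<inter> {..<\<beta>} = \<zeta> ` Pow c"
      by auto
    have "\<exists>Z. increasing_off A I f (\<zeta> ` Pow c \<inter> {..<\<beta>}) Z"
      by (rule increasing_off_below[OF assms(11) inc good])
    then show ?thesis
      unfolding eq .
  qed
  then obtain Z where Z: "\<And>c. |c| <o ordR {..<\<kappa>} \<Longrightarrow> increasing_off A I f (\<zeta> ` Pow c) (Z c)"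
    by metis

  \<comment> \<open>When \<open>a\<close> is not contained in \<open>c\<close> the colour is arbitrary: \<open>PS\<^sup>+\<close> only delivers \<open>c\<close> containing \<open>a\<close>.\<close>
  have "\<exists>t\<in>A. |c| <o ordR {..<\<kappa>} \<longrightarrow> a \<subseteq> c \<longrightarrow> t \<notin> Z c (\<zeta> a)" for a c
  proof (cases "|c| <o ordR {..<\<kappa>} \<and> a \<subseteq> c")
    case True
    then have "Z c (\<zeta> a) \<in> I"
      using Z[of c] by (auto simp: increasing_off_def)
    then have "\<not> A \<subseteq> Z c (\<zeta> a)"
      using assms(11) unfolding ideal_on_def by blast
    then show ?thesis
      by blast
  next
    case False
    then show ?thesis
      using \<open>infinite A\<close> by (metis all_not_in_conv finite.emptyI)
  qed
  then have "\<forall>a c. \<exists>t. t \<in> A \<and> ( |c| <o ordR {..<\<kappa>} \<longrightarrow> a \<subseteq> c \<longrightarrow> t \<notin> Z c (\<zeta> a))"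
    by blast
  then obtain col where "\<forall>a c. col a c \<in> A \<and>
      ( |c| <o ordR {..<\<kappa>} \<longrightarrow> a \<subseteq> c \<longrightarrow> col a c \<notin> Z c (\<zeta> a))"
    unfolding choice_iff by blast
  then have col_in: "\<And>a c. col a c \<in> A"
    and col: "\<And>a c. |c| <o ordR {..<\<kappa>} \<Longrightarrow> a \<subseteq> c \<Longrightarrow> col a c \<notin> Z c (\<zeta> a)"
    by blast+
  obtain B t where B: "B \<in> Iplus (ordR {..<\<kappa>}) (UNIV :: 'o set)"
    and t_in: "\<And>a. a \<in> B \<Longrightarrow> t a \<in> A"
    and meet: "\<And>a b. a \<in> B \<Longrightarrow> b \<in> B \<Longrightarrow>
      \<exists>c. a \<subseteq> c \<and> b \<subseteq> c \<and> c \<in> Pset (ordR {..<\<kappa>}) UNIV \<and> col a c = t a \<and> col b c = t b"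
    using PSplus_colouring[of A "ordR {..<\<kappa>}" UNIV col, OF assms(14) col_in] by metis

  have increasing: "f (\<zeta> a) s < f (\<zeta> b) s"
    if ab: "a \<in> B" "b \<in> B" "t a = s" "t b = s" "\<zeta> a < \<zeta> b" for a b s
  proof -
    obtain c where c: "a \<subseteq> c" "b \<subseteq> c" "|c| <o ordR {..<\<kappa>}" "col a c = s" "col b c = s"
      using meet[OF ab(1,2)] ab(3,4) by (auto simp: Pset_def)
    then have "s \<in> A - (Z c (\<zeta> a) \<union> Z c (\<zeta> b))"
      using col[of c a] col[of c b] col_in[of a c] by auto
    moreover have "\<zeta> a \<in> \<zeta> ` Pow c" "\<zeta> b \<in> \<zeta> ` Pow c"
      using c by auto
    ultimately show ?thesis
      using Z[OF c(3)] ab(5) unfolding increasing_off_def by blast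
  qed

  have "\<exists>s\<in>A. \<forall>x. \<exists>y \<in> \<zeta> ` {a \<in> B. t a = s}. x < y"
  proof (rule ccontr)
    assume "\<not> ?thesis"
    then have "\<forall>s\<in>A. \<exists>u. \<forall>a\<in>B. t a = s \<longrightarrow> \<zeta> a \<le> u"
      by (simp add: not_less) blast
    then obtain u where u: "\<And>a. a \<in> B \<Longrightarrow> \<zeta> a \<le> u (t a)"
      using t_in by metis
    have "|u ` A| <o ordR {..<\<kappa>}"
      using card_of_image assms(8) by (rule ordLeq_ordLess_trans)
    then obtain w where w: "\<forall>x\<in>u ` A. x \<le> w"
      using bounded by blast
    obtain v where v: "w < v"
      using no_max by blast
    obtain b where b: "b \<in> B" "v \<in> b" "|b| <o ordR {..<\<kappa>}"
      using B singleton_small[of v] by (fastforce simp: Iplus_def Pset_def)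
    have "v \<le> \<zeta> b"
      using \<zeta>[OF b(3)] b(2) by blast
    also have "\<dots> \<le> w"
      using u[OF b(1)] w t_in[OF b(1)] by (meson imageI order_trans)
    finally show False
      using v by simp
  qed
  then obtain s where s: "s \<in> A" and unb: "\<forall>x. \<exists>y \<in> \<zeta> ` {a \<in> B. t a = s}. x < y"
    by blast
  let ?H = "\<zeta> ` {a \<in> B. t a = s}"
  have "inj_on (\<lambda>\<alpha>. f \<alpha> s) ?H"
  proof (rule linorder_inj_onI')
    fix \<alpha> \<beta> assume "\<alpha> \<in> ?H" "\<beta> \<in> ?H" "\<alpha> < \<beta>"
    then have "f \<alpha> s < f \<beta> s"
      using increasing by auto
    then show "f \<alpha> s \<noteq> f \<beta> s"
      by simp
  qed
  moreover have "(\<lambda>\<alpha>. f \<alpha> s) ` ?H \<subseteq> {..<lam}"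
  proof -
    have "s \<le> lam"
      using assms(10) s by (auto simp: isLub_def leastP_def isUb_def setle_def setge_def)
    moreover have "f \<alpha> s < s" for \<alpha>
      using assms(15) s by (auto simp: inc_cofinal_seq_def prod_ord_def dest!: PiE_mem)
    ultimately show ?thesis
      by (auto intro: order_less_le_trans)
  qed
  ultimately have "|?H| \<le>o |{..<lam}|"
    using card_of_ordLeq by blast
  then have "|?H| <o ordR (UNIV :: 'o set)"
    using lam_less by (rule ordLeq_ordLess_trans)
  then show False
    using unbounded_regularCard[OF reg unb] not_ordLess_ordIso by blast
qed

end
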